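(* Let $R$ be a commutative ring with $1\neq 0$ and let $M$ be a nonzero unital $R$-module that is not simple. Suppose that $M$ is a multiplication module and that $\mathrm{ann}(M)$ is a prime ideal of $R$. Then the following statements are equivalent: (i) $M$ is Jacobson semisimple, that is, $J(M)=0$; (ii) $G(M)$ is a $T_2$-space; (iii) $G(M)$ is a $T_1$-space; (iv) $G(M)$ is a $T_0$-space; (v) $\widetilde{G(M)}$ is a $T_0$-space; (vi) in $\widetilde{G(M)}$, we have $\overline{\{0\}}=\{0\}$.
   Context: $M$ is a multiplication module if every submodule of $M$ has the form $IM$ for some ideal $I$ of $R$. $\mathrm{ann}(M)=\{r\in R: rM=0\}$. $J(M)$ is the intersection of all maximal submodules of $M$. Let $\mathfrak{B}_M$ be the family of all cosets $m+N$ where $m\in M$ and $N$ is a nonzero submodule of $M$ with $N+Rm=M$. Under the stated hypotheses (which imply that the intersection of any two nonzero submodules of $M$ is nonzero), $\mathfrak{B}_M$ is a basis for a topology on $M$; the set $M$ with this topology (open sets are the unions of members of $\mathfrak{B}_M$) is denoted $\widetilde{G(M)}$. $G(M)$ denotes $M^{\bullet}=M-\{0\}$ with the subspace topology from $\widetilde{G(M)}$. The overline denotes topological closure. *)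

theory Defs
  imports "HOL-Analysis.Analysis" "HOL-Algebra.Module" "HOL-Algebra.Ideal"
begin

text \<open>Modules are those of HOL-Algebra: the locale \<open>module R M\<close> includes that \<open>R\<close> is a commutative
  ring with one (possibly the zero ring) and that \<open>M\<close> is unital.\<close>

definition annihilator :: "('a, 'c) ring_scheme \<Rightarrow> ('a, 'b, 'd) module_scheme \<Rightarrow> 'a set" where
  "annihilator R M = {r \<in> carrier R. \<forall>m \<in> carrier M. r \<odot>\<^bsub>M\<^esub> m = \<zero>\<^bsub>M\<^esub>}"

definition ideal_mult_module ::
  "'a set \<Rightarrow> ('a, 'b, 'd) module_scheme \<Rightarrow> 'b set" where
  "ideal_mult_module I M =
     {finsum M (\<lambda>i. a i \<odot>\<^bsub>M\<^esub> x i) {..<n} | (n :: nat) a x.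
        a \<in> {..<n} \<rightarrow> I \<and> x \<in> {..<n} \<rightarrow> carrier M}"

definition multiplication_module ::
  "('a, 'c) ring_scheme \<Rightarrow> ('a, 'b, 'd) module_scheme \<Rightarrow> bool" where
  "multiplication_module R M \<longleftrightarrow>
     (\<forall>N. submodule N R M \<longrightarrow> (\<exists>I. ideal I R \<and> N = ideal_mult_module I M))"

definition simple_module :: "('a, 'c) ring_scheme \<Rightarrow> ('a, 'b, 'd) module_scheme \<Rightarrow> bool" where
  "simple_module R M \<longleftrightarrow> carrier M \<noteq> {\<zero>\<^bsub>M\<^esub>} \<and>
     (\<forall>N. submodule N R M \<longrightarrow> N = {\<zero>\<^bsub>M\<^esub>} \<or> N = carrier M)"

definition maximal_submodule ::
  "'b set \<Rightarrow> ('a, 'c) ring_scheme \<Rightarrow> ('a, 'b, 'd) module_scheme \<Rightarrow> bool" where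
  "maximal_submodule N R M \<longleftrightarrow> submodule N R M \<and> N \<noteq> carrier M \<and>
     (\<forall>L. submodule L R M \<and> N \<subseteq> L \<longrightarrow> L = N \<or> L = carrier M)"

text \<open>The intersection with \<open>carrier M\<close> makes the radical all of \<open>M\<close> if there are no maximal
  submodules.\<close>

definition jacobson_radical ::
  "('a, 'c) ring_scheme \<Rightarrow> ('a, 'b, 'd) module_scheme \<Rightarrow> 'b set" where
  "jacobson_radical R M = carrier M \<inter> \<Inter>{N. maximal_submodule N R M}"

definition cyclic_submodule ::
  "('a, 'c) ring_scheme \<Rightarrow> ('a, 'b, 'd) module_scheme \<Rightarrow> 'b \<Rightarrow> 'b set" where
  "cyclic_submodule R M m = {r \<odot>\<^bsub>M\<^esub> m | r. r \<in> carrier R}"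

definition golomb_basis ::
  "('a, 'c) ring_scheme \<Rightarrow> ('a, 'b, 'd) module_scheme \<Rightarrow> 'b set set" where
  "golomb_basis R M =
     {m <+\<^bsub>M\<^esub> N | m N. m \<in> carrier M \<and> submodule N R M \<and> N \<noteq> {\<zero>\<^bsub>M\<^esub>} \<and>
        N <+>\<^bsub>M\<^esub> cyclic_submodule R M m = carrier M}"

text \<open>Since \<open>topology\<close> is only meaningful on predicates that do define a topology, the
  lemmas at the end of the theory show that this is the case for multiplication modules with prime
  annihilator, with \<open>carrier M\<close> as underlying set.\<close>

definition golomb_topology_full ::
  "('a, 'c) ring_scheme \<Rightarrow> ('a, 'b, 'd) module_scheme \<Rightarrow> 'b topology" where
  "golomb_topology_full R M = topology (arbitrary union_of (\<lambda>U. U \<in> golomb_basis R M))"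

definition golomb_topology ::
  "('a, 'c) ring_scheme \<Rightarrow> ('a, 'b, 'd) module_scheme \<Rightarrow> 'b topology" where
  "golomb_topology R M = subtopology (golomb_topology_full R M) (carrier M - {\<zero>\<^bsub>M\<^esub>})"

context Module.module
begin

lemma cyclic_submodule_is_submodule:
  assumes "x \<in> carrier M"
  shows "submodule (cyclic_submodule R M x) R M"
proof (rule submoduleI)
  show "cyclic_submodule R M x \<subseteq> carrier M"
    using assms by (auto simp: cyclic_submodule_def)
  show "\<zero>\<^bsub>M\<^esub> \<in> cyclic_submodule R M x"
    using assms smult_l_null[OF assms] unfolding cyclic_submodule_def by force
next
  fix a assume "a \<in> cyclic_submodule R M x"
  then obtain r where "r \<in> carrier R" "a = r \<odot>\<^bsub>M\<^esub> x"
    by (auto simp: cyclic_submodule_def)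
  then have "\<ominus> r \<in> carrier R" "\<ominus>\<^bsub>M\<^esub> a = (\<ominus> r) \<odot>\<^bsub>M\<^esub> x"
    using assms smult_l_minus[of r x] by auto
  then show "\<ominus>\<^bsub>M\<^esub> a \<in> cyclic_submodule R M x"
    unfolding cyclic_submodule_def by blast
next
  fix a b assume "a \<in> cyclic_submodule R M x" "b \<in> cyclic_submodule R M x"
  then obtain r s where "r \<in> carrier R" "a = r \<odot>\<^bsub>M\<^esub> x" "s \<in> carrier R" "b = s \<odot>\<^bsub>M\<^esub> x"
    by (auto simp: cyclic_submodule_def)
  then have "r \<oplus> s \<in> carrier R" "a \<oplus>\<^bsub>M\<^esub> b = (r \<oplus> s) \<odot>\<^bsub>M\<^esub> x"
    using assms smult_l_distr[of r s x] by auto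
  then show "a \<oplus>\<^bsub>M\<^esub> b \<in> cyclic_submodule R M x"
    unfolding cyclic_submodule_def by blast
next
  fix a y assume "a \<in> carrier R" "y \<in> cyclic_submodule R M x"
  then obtain r where "r \<in> carrier R" "y = r \<odot>\<^bsub>M\<^esub> x"
    by (auto simp: cyclic_submodule_def)
  then have "a \<otimes> r \<in> carrier R" "a \<odot>\<^bsub>M\<^esub> y = (a \<otimes> r) \<odot>\<^bsub>M\<^esub> x"
    using assms \<open>a \<in> carrier R\<close> smult_assoc1[of a r x] by auto
  then show "a \<odot>\<^bsub>M\<^esub> y \<in> cyclic_submodule R M x"
    unfolding cyclic_submodule_def by blast
qed

lemma set_add_submodule:
  assumes "submodule H R M" "submodule K R M"
  shows "submodule (H <+>\<^bsub>M\<^esub> K) R M"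
proof -
  have sub: "H \<subseteq> carrier M" "K \<subseteq> carrier M"
    using submoduleE(1) assms by auto
  have "subgroup (H <+>\<^bsub>M\<^esub> K) (add_monoid M)"
    unfolding set_add_def
    by (rule comm_group.mult_subgroups)
      (use assms a_comm_group in \<open>auto intro: submodule.axioms\<close>)
  moreover have "r \<odot>\<^bsub>M\<^esub> z \<in> H <+>\<^bsub>M\<^esub> K"
    if rz: "r \<in> carrier R" "z \<in> H <+>\<^bsub>M\<^esub> K" for r z
  proof -
    obtain h k where hk: "h \<in> H" "k \<in> K" "z = h \<oplus>\<^bsub>M\<^esub> k"
      using rz by (auto simp: set_add_def')
    then have "r \<odot>\<^bsub>M\<^esub> z = r \<odot>\<^bsub>M\<^esub> h \<oplus>\<^bsub>M\<^esub> r \<odot>\<^bsub>M\<^esub> k"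
      using smult_r_distr[of r h k] rz sub by blast
    moreover have "r \<odot>\<^bsub>M\<^esub> h \<in> H" "r \<odot>\<^bsub>M\<^esub> k \<in> K"
      using submoduleE(4) assms hk rz by auto
    ultimately show ?thesis unfolding set_add_def' by blast
  qed
  ultimately show ?thesis
    by (simp add: submodule_def submodule_axioms_def)
qed

lemma ideal_mult_module_subset:
  assumes "submodule S R M" and "\<And>a m. a \<in> I \<Longrightarrow> m \<in> carrier M \<Longrightarrow> a \<odot>\<^bsub>M\<^esub> m \<in> S"
  shows "ideal_mult_module I M \<subseteq> S"
proof -
  have sub: "S \<subseteq> carrier M" using submoduleE(1) assms by auto
  have z: "\<zero>\<^bsub>M\<^esub> \<in> S" using subgroup.one_closed submodule.axioms(1)[OF assms(1)] by force
  have "finsum M f {..<n} \<in> S" if "f \<in> {..<n} \<rightarrow> S" for f and n :: nat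
    using that
  proof (induction n)
    case 0
    then show ?case using z by simp
  next
    case (Suc n)
    have f: "f \<in> {..<n} \<rightarrow> S" "f n \<in> S" using Suc.prems by auto
    have "finsum M f {..<n} \<in> S" by (rule Suc.IH) (rule f)
    note this f(2)
    moreover have "finsum M f {..<Suc n} = f n \<oplus>\<^bsub>M\<^esub> finsum M f {..<n}"
      unfolding lessThan_Suc by (rule M.finsum_insert) (use Suc.prems sub in auto)
    ultimately show ?case using submoduleE(5)[OF assms(1)] by simp
  qed
  then show ?thesis
    using assms(2) unfolding ideal_mult_module_def by (auto simp: Pi_iff)
qed

lemma mem_ideal_mult_module:
  assumes "a \<in> I" "I \<subseteq> carrier R" "m \<in> carrier M"
  shows "a \<odot>\<^bsub>M\<^esub> m \<in> ideal_mult_module I M"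
proof -
  have "a \<odot>\<^bsub>M\<^esub> m \<in> carrier M" using assms by auto
  then have "a \<odot>\<^bsub>M\<^esub> m = finsum M (\<lambda>i. (\<lambda>_. a) i \<odot>\<^bsub>M\<^esub> (\<lambda>_. m) i) {..<Suc 0}"
    by (simp add: lessThan_Suc)
  moreover have "(\<lambda>_. a) \<in> {..<Suc 0} \<rightarrow> I \<and> (\<lambda>_. m) \<in> {..<Suc 0} \<rightarrow> carrier M"
    using assms by auto
  ultimately show ?thesis unfolding ideal_mult_module_def mem_Collect_eq
    by (intro exI[of _ "Suc 0"] exI[of _ "\<lambda>_. a"] exI[of _ "\<lambda>_. m"]) simp
qed

lemma submodule_Int:
  assumes "submodule N R M" "submodule L R M"
  shows "submodule (N \<inter> L) R M"
  using assms group.subgroups_Inter_pair[of "add_monoid M" N L] a_group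
  by (auto simp: submodule_def submodule_axioms_def)

lemma submodule_Int_nonzero:
  assumes "multiplication_module R M" "primeideal (annihilator R M) R"
    and N: "submodule N R M" "N \<noteq> {\<zero>\<^bsub>M\<^esub>}" and L: "submodule L R M" "L \<noteq> {\<zero>\<^bsub>M\<^esub>}"
  shows "N \<inter> L \<noteq> {\<zero>\<^bsub>M\<^esub>}"
proof
  assume int: "N \<inter> L = {\<zero>\<^bsub>M\<^esub>}"
  obtain I where I: "ideal I R" "N = ideal_mult_module I M"
    using assms unfolding multiplication_module_def by blast
  obtain J where J: "ideal J R" "L = ideal_mult_module J M"
    using assms unfolding multiplication_module_def by blast
  have IR: "I \<subseteq> carrier R" "J \<subseteq> carrier R"
    using ideal.Icarr[OF I(1)] ideal.Icarr[OF J(1)] by auto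
  have sm0: "submodule {\<zero>\<^bsub>M\<^esub>} R M"
    by (rule submoduleI) auto
  have z: "\<zero>\<^bsub>M\<^esub> \<in> N" "\<zero>\<^bsub>M\<^esub> \<in> L" using int by auto
  have "\<exists>a \<in> I. a \<notin> annihilator R M"
  proof (rule ccontr)
    assume "\<not> ?thesis"
    then have "N \<subseteq> {\<zero>\<^bsub>M\<^esub>}"
      unfolding I(2) by (intro ideal_mult_module_subset[OF sm0]) (auto simp: annihilator_def)
    then show False using N z by auto
  qed
  then obtain a where a: "a \<in> I" "a \<notin> annihilator R M" by auto
  have "\<exists>b \<in> J. b \<notin> annihilator R M"
  proof (rule ccontr)
    assume "\<not> ?thesis"
    then have "L \<subseteq> {\<zero>\<^bsub>M\<^esub>}"
      unfolding J(2) by (intro ideal_mult_module_subset[OF sm0]) (auto simp: annihilator_def)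
    then show False using L z by auto
  qed
  then obtain b where b: "b \<in> J" "b \<notin> annihilator R M" by auto
  have "(a \<otimes> b) \<odot>\<^bsub>M\<^esub> m = \<zero>\<^bsub>M\<^esub>" if m: "m \<in> carrier M" for m
  proof -
    have bm: "b \<odot>\<^bsub>M\<^esub> m \<in> L" unfolding J(2) using mem_ideal_mult_module b m IR by auto
    have "a \<odot>\<^bsub>M\<^esub> (b \<odot>\<^bsub>M\<^esub> m) \<in> L" using submoduleE(4)[OF L(1)] bm a IR by auto
    moreover have "a \<odot>\<^bsub>M\<^esub> (b \<odot>\<^bsub>M\<^esub> m) \<in> N"
      unfolding I(2) by (rule mem_ideal_mult_module) (use a b m IR in auto)
    ultimately have "a \<odot>\<^bsub>M\<^esub> (b \<odot>\<^bsub>M\<^esub> m) = \<zero>\<^bsub>M\<^esub>" using int by blast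
    moreover have "a \<in> carrier R" "b \<in> carrier R" using a b IR by auto
    ultimately show ?thesis using smult_assoc1[of a b m] m by simp
  qed
  then have "a \<otimes> b \<in> annihilator R M" using a b IR by (auto simp: annihilator_def)
  then show False using primeideal.I_prime[OF assms(2), of a b] a b IR by auto
qed

lemma submodule_Int_comaximal:
  assumes "multiplication_module R M" "x \<in> carrier M"
    and N: "submodule N R M" "N <+>\<^bsub>M\<^esub> cyclic_submodule R M x = carrier M"
    and L: "submodule L R M" "L <+>\<^bsub>M\<^esub> cyclic_submodule R M x = carrier M"
  shows "(N \<inter> L) <+>\<^bsub>M\<^esub> cyclic_submodule R M x = carrier M"
proof -
  let ?C = "cyclic_submodule R M x"
  let ?S = "(N \<inter> L) <+>\<^bsub>M\<^esub> ?C"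
  obtain I where I: "ideal I R" "N = ideal_mult_module I M"
    using assms unfolding multiplication_module_def by blast
  have IR: "I \<subseteq> carrier R"
    using ideal.Icarr[OF I(1)] by auto
  have C: "submodule ?C R M" by (rule cyclic_submodule_is_submodule) fact
  have S: "submodule ?S R M" by (intro set_add_submodule submodule_Int C N L)
  have sub: "N \<subseteq> carrier M" "L \<subseteq> carrier M" "?C \<subseteq> carrier M" "?S \<subseteq> carrier M"
    using submoduleE(1) N L C S by auto
  have z: "\<zero>\<^bsub>M\<^esub> \<in> N \<inter> L"
    using subgroup.one_closed submodule.axioms(1) N L by force
  have CS: "?C \<subseteq> ?S"
  proof
    fix c assume c: "c \<in> ?C"
    then have "c = \<zero>\<^bsub>M\<^esub> \<oplus>\<^bsub>M\<^esub> c" using sub by auto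
    then show "c \<in> ?S" using z c unfolding set_add_def' by blast
  qed
  have "N \<subseteq> ?S" unfolding I(2)
  proof (rule ideal_mult_module_subset[OF S[unfolded I(2)]])
    fix a m assume a: "a \<in> I" and m: "m \<in> carrier M"
    have aR: "a \<in> carrier R" using a IR by auto
    obtain l c where lc: "l \<in> L" "c \<in> ?C" "m = l \<oplus>\<^bsub>M\<^esub> c"
      using m L(2) unfolding set_add_def' by blast
    have "a \<odot>\<^bsub>M\<^esub> m = a \<odot>\<^bsub>M\<^esub> l \<oplus>\<^bsub>M\<^esub> a \<odot>\<^bsub>M\<^esub> c"
      using smult_r_distr[of a l c] lc sub aR by blast
    moreover have "a \<odot>\<^bsub>M\<^esub> l \<in> N"
      unfolding I(2) by (rule mem_ideal_mult_module) (use a lc sub IR in auto)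
    moreover have "a \<odot>\<^bsub>M\<^esub> l \<in> L" "a \<odot>\<^bsub>M\<^esub> c \<in> ?C"
      using submoduleE(4) L(1) C lc aR by auto
    ultimately have "a \<odot>\<^bsub>M\<^esub> m \<in> ?S" unfolding set_add_def' by blast
    then show "a \<odot>\<^bsub>M\<^esub> m \<in> (ideal_mult_module I M \<inter> L) <+>\<^bsub>M\<^esub> ?C"
      by (simp add: I(2))
  qed
  have "carrier M \<subseteq> ?S"
  proof
    fix m assume "m \<in> carrier M"
    then obtain n c where "n \<in> N" "c \<in> ?C" "m = n \<oplus>\<^bsub>M\<^esub> c"
      using N(2) unfolding set_add_def' by blast
    then show "m \<in> ?S" using \<open>N \<subseteq> ?S\<close> CS submoduleE(5)[OF S] by blast
  qed
  then show ?thesis using sub by auto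
qed

lemma comaximal_coset:
  assumes "m \<in> carrier M" "submodule N R M" "x \<in> m <+\<^bsub>M\<^esub> N"
    and "N <+>\<^bsub>M\<^esub> cyclic_submodule R M m = carrier M"
  shows "N <+>\<^bsub>M\<^esub> cyclic_submodule R M x = carrier M"
proof -
  have sub: "N \<subseteq> carrier M" using submoduleE(1) assms by auto
  obtain n where n: "n \<in> N" "x = m \<oplus>\<^bsub>M\<^esub> n"
    using assms by (auto simp: a_l_coset_def')
  have nc: "n \<in> carrier M" and xc: "x \<in> carrier M" using n sub assms by auto
  have "y \<in> N <+>\<^bsub>M\<^esub> cyclic_submodule R M x" if y: "y \<in> carrier M" for y
  proof -
    obtain n' r where r: "n' \<in> N" "r \<in> carrier R" "y = n' \<oplus>\<^bsub>M\<^esub> r \<odot>\<^bsub>M\<^esub> m"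
      using y assms(4) unfolding set_add_def' cyclic_submodule_def by blast
    have rn: "r \<odot>\<^bsub>M\<^esub> n \<in> N" using submoduleE(4) assms r n by auto
    have "n' \<oplus>\<^bsub>M\<^esub> (\<ominus>\<^bsub>M\<^esub> (r \<odot>\<^bsub>M\<^esub> n)) \<in> N"
      using submoduleE(5)[OF assms(2)] submoduleE(3)[OF assms(2)] rn r by auto
    moreover have "y = (n' \<oplus>\<^bsub>M\<^esub> (\<ominus>\<^bsub>M\<^esub> (r \<odot>\<^bsub>M\<^esub> n))) \<oplus>\<^bsub>M\<^esub> r \<odot>\<^bsub>M\<^esub> x"
    proof -
      have c: "n' \<in> carrier M" "r \<odot>\<^bsub>M\<^esub> n \<in> carrier M" "r \<odot>\<^bsub>M\<^esub> m \<in> carrier M"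
        using r sub nc assms(1) by auto
      have "r \<odot>\<^bsub>M\<^esub> x = r \<odot>\<^bsub>M\<^esub> n \<oplus>\<^bsub>M\<^esub> r \<odot>\<^bsub>M\<^esub> m"
        using smult_r_distr[of r m n] r nc assms(1) n c by (simp add: M.a_comm)
      then show ?thesis using r c
        by (simp add: M.a_assoc M.r_neg2 M.r_neg1)
    qed
    ultimately show ?thesis using r unfolding set_add_def' cyclic_submodule_def by blast
  qed
  moreover have "N <+>\<^bsub>M\<^esub> cyclic_submodule R M x \<subseteq> carrier M"
    by (intro submoduleE(1) set_add_submodule cyclic_submodule_is_submodule assms xc)
  ultimately show ?thesis by auto
qed

lemma coset_subset:
  assumes "m \<in> carrier M" "submodule N R M" "x \<in> m <+\<^bsub>M\<^esub> N" "K \<subseteq> N"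
  shows "x <+\<^bsub>M\<^esub> K \<subseteq> m <+\<^bsub>M\<^esub> N"
proof
  fix y assume "y \<in> x <+\<^bsub>M\<^esub> K"
  then obtain k n where kn: "k \<in> N" "y = x \<oplus>\<^bsub>M\<^esub> k" "n \<in> N" "x = m \<oplus>\<^bsub>M\<^esub> n"
    using assms by (auto simp: a_l_coset_def')
  have sub: "N \<subseteq> carrier M" using submoduleE(1) assms by auto
  then have "y = m \<oplus>\<^bsub>M\<^esub> (n \<oplus>\<^bsub>M\<^esub> k)" using kn assms(1) M.a_assoc[of m n k] by blast
  moreover have "n \<oplus>\<^bsub>M\<^esub> k \<in> N" using submoduleE(5) assms kn by auto
  ultimately show "y \<in> m <+\<^bsub>M\<^esub> N" unfolding a_l_coset_def' by blast
qed

lemma golomb_basis_subset_carrier: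
  assumes "U \<in> golomb_basis R M"
  shows "U \<subseteq> carrier M"
proof -
  obtain m N where mN: "U = m <+\<^bsub>M\<^esub> N" "m \<in> carrier M" "submodule N R M"
    using assms unfolding golomb_basis_def by blast
  then show ?thesis
    using submoduleE(1)[OF mN(3)] unfolding a_l_coset_def' by auto
qed

lemma golomb_basis_Int:
  assumes "multiplication_module R M" "primeideal (annihilator R M) R"
    and "U \<in> golomb_basis R M" "V \<in> golomb_basis R M" "x \<in> U \<inter> V"
  shows "\<exists>W \<in> golomb_basis R M. x \<in> W \<and> W \<subseteq> U \<inter> V"
proof -
  obtain m N where N: "U = m <+\<^bsub>M\<^esub> N" "m \<in> carrier M" "submodule N R M" "N \<noteq> {\<zero>\<^bsub>M\<^esub>}"
    "N <+>\<^bsub>M\<^esub> cyclic_submodule R M m = carrier M"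
    using assms(3) unfolding golomb_basis_def by auto
  obtain l L where L: "V = l <+\<^bsub>M\<^esub> L" "l \<in> carrier M" "submodule L R M" "L \<noteq> {\<zero>\<^bsub>M\<^esub>}"
    "L <+>\<^bsub>M\<^esub> cyclic_submodule R M l = carrier M"
    using assms(4) unfolding golomb_basis_def by auto
  have x: "x \<in> carrier M" "x \<in> m <+\<^bsub>M\<^esub> N" "x \<in> l <+\<^bsub>M\<^esub> L"
    using golomb_basis_subset_carrier assms N L by auto
  let ?W = "x <+\<^bsub>M\<^esub> (N \<inter> L)"
  have "(N \<inter> L) <+>\<^bsub>M\<^esub> cyclic_submodule R M x = carrier M"
    by (rule submodule_Int_comaximal[OF assms(1) x(1) N(3) comaximal_coset[OF N(2,3) x(2) N(5)]
          L(3) comaximal_coset[OF L(2,3) x(3) L(5)]])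
  moreover have "submodule (N \<inter> L) R M" "N \<inter> L \<noteq> {\<zero>\<^bsub>M\<^esub>}"
    by (rule submodule_Int[OF N(3) L(3)],
        rule submodule_Int_nonzero[OF assms(1,2) N(3,4) L(3,4)])
  ultimately have "?W \<in> golomb_basis R M"
    using x(1) unfolding golomb_basis_def by blast
  moreover have "?W \<subseteq> U \<inter> V"
    using coset_subset N L x by auto
  moreover have "\<zero>\<^bsub>M\<^esub> \<in> N \<inter> L"
    using subgroup.one_closed submodule.axioms(1) N L by force
  then have "x \<in> ?W" using x(1) M.r_zero[OF x(1)] unfolding a_l_coset_def' by force
  ultimately show ?thesis by blast
qed

lemma openin_golomb_topology_full:
  assumes "multiplication_module R M" "primeideal (annihilator R M) R"
  shows "openin (golomb_topology_full R M) U \<longleftrightarrow> (\<exists>\<F> \<subseteq> golomb_basis R M. U = \<Union>\<F>)"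
proof -
  have "istopology (arbitrary union_of (\<lambda>U. U \<in> golomb_basis R M))"
    unfolding istopology_base_eq
  proof (intro allI impI)
    fix S T assume "S \<in> golomb_basis R M \<and> T \<in> golomb_basis R M"
    then have "\<forall>x \<in> S \<inter> T. \<exists>W \<in> golomb_basis R M. x \<in> W \<and> W \<subseteq> S \<inter> T"
      using golomb_basis_Int[OF assms] by blast
    then have "S \<inter> T = \<Union>{W \<in> golomb_basis R M. W \<subseteq> S \<inter> T}" by blast
    then show "(arbitrary union_of (\<lambda>U. U \<in> golomb_basis R M)) (S \<inter> T)"
      unfolding union_of_def arbitrary_def by (intro exI[of _ "{W \<in> golomb_basis R M. W \<subseteq> S \<inter> T}"]) auto
  qed
  then show ?thesis
    unfolding golomb_topology_full_def by (auto simp: topology_inverse' union_of_def arbitrary_def)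
qed

lemma topspace_golomb_topology_full:
  assumes "multiplication_module R M" "primeideal (annihilator R M) R" "carrier M \<noteq> {\<zero>\<^bsub>M\<^esub>}"
  shows "topspace (golomb_topology_full R M) = carrier M"
proof -
  have z: "\<zero>\<^bsub>M\<^esub> <+\<^bsub>M\<^esub> carrier M = carrier M"
    by (force simp: a_l_coset_def')
  have "carrier M <+>\<^bsub>M\<^esub> cyclic_submodule R M \<zero>\<^bsub>M\<^esub> = carrier M"
  proof -
    have "\<zero>\<^bsub>M\<^esub> \<in> cyclic_submodule R M \<zero>\<^bsub>M\<^esub>" "cyclic_submodule R M \<zero>\<^bsub>M\<^esub> \<subseteq> carrier M"
      unfolding cyclic_submodule_def by (auto intro!: exI[of _ \<zero>])
    then show ?thesis unfolding set_add_def' by force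
  qed
  then have "\<zero>\<^bsub>M\<^esub> <+\<^bsub>M\<^esub> carrier M \<in> golomb_basis R M"
    using assms(3) carrier_is_submodule unfolding golomb_basis_def by blast
  then have "carrier M \<in> golomb_basis R M"
    by (simp add: z)
  then have "openin (golomb_topology_full R M) (carrier M)"
    unfolding openin_golomb_topology_full[OF assms(1,2)] by (intro exI[of _ "{carrier M}"]) auto
  moreover have "topspace (golomb_topology_full R M) \<subseteq> carrier M"
    using openin_topspace[of "golomb_topology_full R M"] golomb_basis_subset_carrier
    unfolding openin_golomb_topology_full[OF assms(1,2)] by blast
  ultimately show ?thesis using openin_subset by blast
qed

end

end

theory Submission
  imports Defs
begin

text \<open>
  Everything rests on one description of the Jacobson radical: \<open>x\<close> lies in \<open>J(M)\<close> exactly if \<open>R x\<close>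
  is superfluous, meaning that \<open>N + R x = M\<close> forces \<open>N = M\<close>
  (\<open>mem_jacobson_radical_iff_superfluous\<close>). Since the basic neighbourhoods of \<open>x\<close> are the cosets
  \<open>x + N\<close> with \<open>N \<noteq> 0\<close> and \<open>N + R x = M\<close>, the points of \<open>J(M)\<close> are those whose only neighbourhood
  is \<open>M\<close> itself; here non-simplicity enters, because it makes every maximal submodule \<open>L\<close> nonzero
  and hence \<open>x + L\<close> a neighbourhood of every \<open>x \<notin> L\<close>. In particular the closure of \<open>0\<close> is \<open>J(M)\<close>,
  so the radical vanishes exactly if \<open>0\<close> is a closed point.

  If \<open>J(M) = 0\<close>, distinct nonzero \<open>x\<close> and \<open>y\<close> are separated by the cosets of a single maximal
  submodule \<open>L\<close> that contains none of \<open>x\<close>, \<open>y\<close>, \<open>x - y\<close>. Such an \<open>L\<close> exists because any two nonzero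
  submodules intersect nontrivially: a nonzero \<open>z\<close> in \<open>R x \<inter> R y \<inter> R (x - y)\<close> is avoided by some
  maximal submodule, which then avoids the three generators.

  If \<open>J(M) \<noteq> 0\<close>, two distinct nonzero points of \<open>J(M)\<close> cannot be told apart by open sets, so all
  that matters is that \<open>J(M)\<close> has more than one nonzero element. For a proper nonzero submodule
  \<open>N\<close> some \<open>a\<close> outside \<open>ann(M)\<close> maps \<open>M\<close> into \<open>N\<close>. As \<open>M\<close> is torsion-free over \<open>R / ann(M)\<close>, a
  nonzero \<open>x \<in> J(M)\<close> gives \<open>a x \<noteq> 0\<close>, and \<open>a x = x\<close> would make \<open>a\<close> act as the identity on \<open>M\<close>,
  that is, \<open>N = M\<close>. So \<open>x\<close> and \<open>a x\<close> are two such elements.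
\<close>

section \<open>Submodules and the Jacobson radical\<close>

context Module.module
begin

lemma submodule_zero_mem: "submodule N R M \<Longrightarrow> \<zero>\<^bsub>M\<^esub> \<in> N"
  using subgroup.one_closed submodule.axioms(1) by force

lemma zero_submodule: "submodule {\<zero>\<^bsub>M\<^esub>} R M"
  by (rule submoduleI) auto

lemma cyclic_submodule_self: "x \<in> carrier M \<Longrightarrow> x \<in> cyclic_submodule R M x"
  unfolding cyclic_submodule_def by (auto intro!: exI[of _ \<one>])

lemma cyclic_submodule_subset_iff:
  assumes "submodule N R M" "x \<in> carrier M"
  shows "cyclic_submodule R M x \<subseteq> N \<longleftrightarrow> x \<in> N"
  using cyclic_submodule_self[OF assms(2)] submoduleE(4)[OF assms(1)]
  unfolding cyclic_submodule_def by blast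

lemma cyclic_submodule_nonzero:
  assumes "x \<in> carrier M" "x \<noteq> \<zero>\<^bsub>M\<^esub>"
  shows "cyclic_submodule R M x \<noteq> {\<zero>\<^bsub>M\<^esub>}"
  using cyclic_submodule_self assms by blast

lemma set_add_subset_submodule:
  assumes "submodule S R M" "N \<subseteq> S" "L \<subseteq> S"
  shows "N <+>\<^bsub>M\<^esub> L \<subseteq> S"
  using submoduleE(5)[OF assms(1)] assms(2,3) unfolding set_add_def' by blast

lemma subset_set_add_left:
  assumes "submodule N R M" "submodule L R M"
  shows "N \<subseteq> N <+>\<^bsub>M\<^esub> L"
proof
  fix n assume "n \<in> N"
  moreover from this have "n = n \<oplus>\<^bsub>M\<^esub> \<zero>\<^bsub>M\<^esub>" using submoduleE(1)[OF assms(1)] by auto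
  ultimately show "n \<in> N <+>\<^bsub>M\<^esub> L"
    using submodule_zero_mem[OF assms(2)] unfolding set_add_def' by blast
qed

lemma subset_set_add_right:
  assumes "submodule N R M" "submodule L R M"
  shows "L \<subseteq> N <+>\<^bsub>M\<^esub> L"
proof
  fix l assume "l \<in> L"
  moreover from this have "l = \<zero>\<^bsub>M\<^esub> \<oplus>\<^bsub>M\<^esub> l" using submoduleE(1)[OF assms(2)] by auto
  ultimately show "l \<in> N <+>\<^bsub>M\<^esub> L"
    using submodule_zero_mem[OF assms(1)] unfolding set_add_def' by blast
qed

lemma submodule_minus_mem:
  assumes "submodule N R M" "x \<in> N" "y \<in> N"
  shows "x \<ominus>\<^bsub>M\<^esub> y \<in> N"
  using submoduleE(3,5)[OF assms(1)] assms(2,3) by (simp add: a_minus_def)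

lemma minus_eq_zero_iff:
  assumes "x \<in> carrier M" "y \<in> carrier M"
  shows "x \<ominus>\<^bsub>M\<^esub> y = \<zero>\<^bsub>M\<^esub> \<longleftrightarrow> x = y"
  using assms M.minus_equality[of x "\<ominus>\<^bsub>M\<^esub> y"] by (auto simp: a_minus_def M.r_neg)

lemma coset_mem_iff:
  assumes "x \<in> carrier M" "y \<in> carrier M" "submodule N R M"
  shows "y \<in> x <+\<^bsub>M\<^esub> N \<longleftrightarrow> y \<ominus>\<^bsub>M\<^esub> x \<in> N"
proof
  assume "y \<in> x <+\<^bsub>M\<^esub> N"
  then obtain n where n: "n \<in> N" "y = x \<oplus>\<^bsub>M\<^esub> n" by (auto simp: a_l_coset_def')
  then have "n \<in> carrier M" using submoduleE(1)[OF assms(3)] by blast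
  then have "y \<ominus>\<^bsub>M\<^esub> x = n"
    using n assms(1) by (simp add: a_minus_def M.a_comm[of x n] M.a_assoc M.r_neg)
  then show "y \<ominus>\<^bsub>M\<^esub> x \<in> N" using n by simp
next
  assume "y \<ominus>\<^bsub>M\<^esub> x \<in> N"
  moreover have "y = x \<oplus>\<^bsub>M\<^esub> (y \<ominus>\<^bsub>M\<^esub> x)"
    using assms(1,2) by (simp add: a_minus_def M.a_comm[of y] M.r_neg2)
  ultimately show "y \<in> x <+\<^bsub>M\<^esub> N" unfolding a_l_coset_def' by blast
qed

lemma submodule_Union_chain:
  assumes "\<C> \<noteq> {}" "\<And>N. N \<in> \<C> \<Longrightarrow> submodule N R M"
    and chain: "\<And>N L. N \<in> \<C> \<Longrightarrow> L \<in> \<C> \<Longrightarrow> N \<subseteq> L \<or> L \<subseteq> N"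
  shows "submodule (\<Union>\<C>) R M"
proof (rule submoduleI)
  show "\<Union>\<C> \<subseteq> carrier M" using submoduleE(1) assms(2) by blast
  show "\<zero>\<^bsub>M\<^esub> \<in> \<Union>\<C>" using submodule_zero_mem assms(1,2) by blast
  show "\<ominus>\<^bsub>M\<^esub> a \<in> \<Union>\<C>" if "a \<in> \<Union>\<C>" for a
    using submoduleE(3) assms(2) that by blast
  show "a \<oplus>\<^bsub>M\<^esub> b \<in> \<Union>\<C>" if ab: "a \<in> \<Union>\<C>" "b \<in> \<Union>\<C>" for a b
  proof -
    obtain N L where "N \<in> \<C>" "a \<in> N" "L \<in> \<C>" "b \<in> L" using ab by auto
    then obtain K where "K \<in> \<C>" "a \<in> K" "b \<in> K" using chain by blast
    then show ?thesis using submoduleE(5)[OF assms(2)] by blast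
  qed
  show "a \<odot>\<^bsub>M\<^esub> x \<in> \<Union>\<C>" if "a \<in> carrier R" "x \<in> \<Union>\<C>" for a x
    using submoduleE(4)[OF assms(2)] that by blast
qed

text \<open>Maximal submodules need not exist above an arbitrary proper submodule of a module that is not
  finitely generated. They do exist here: among the submodules that contain \<open>N\<close> but not \<open>x\<close>, a
  maximal one is a maximal submodule, because anything larger contains \<open>N + R x\<close>.\<close>

lemma exists_maximal_submodule_avoiding:
  assumes N: "submodule N R M" and x: "x \<in> carrier M" "x \<notin> N"
    and comax: "N <+>\<^bsub>M\<^esub> cyclic_submodule R M x = carrier M"
  shows "\<exists>L. maximal_submodule L R M \<and> N \<subseteq> L \<and> x \<notin> L"
proof -
  let ?A = "{L. submodule L R M \<and> N \<subseteq> L \<and> x \<notin> L}"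
  have "\<exists>L \<in> ?A. \<forall>K \<in> ?A. L \<subseteq> K \<longrightarrow> K = L"
  proof (rule subset_Zorn_nonempty)
    show "?A \<noteq> {}" using N x by blast
    fix \<C> assume \<C>: "\<C> \<noteq> {}" "subset.chain ?A \<C>"
    have "submodule (\<Union>\<C>) R M"
      by (rule submodule_Union_chain) (use \<C> in \<open>auto simp: subset_chain_def\<close>)
    then show "\<Union>\<C> \<in> ?A" using \<C> by (auto simp: subset_chain_def)
  qed
  then obtain L where LA: "L \<in> ?A" and max: "\<forall>K \<in> ?A. L \<subseteq> K \<longrightarrow> K = L" ..
  then have L: "submodule L R M" "N \<subseteq> L" "x \<notin> L" by auto
  have "K = L \<or> K = carrier M" if K: "submodule K R M" "L \<subseteq> K" for K
  proof (cases "x \<in> K")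
    case True
    have "N \<subseteq> K" "cyclic_submodule R M x \<subseteq> K"
      using L(2) K True cyclic_submodule_subset_iff[OF K(1) x(1)] by auto
    then have "carrier M \<subseteq> K"
      using set_add_subset_submodule[OF K(1)] comax by metis
    then show ?thesis using submoduleE(1)[OF K(1)] by simp
  next
    case False
    then have "K \<in> ?A" using K L(2) by simp
    then show ?thesis using max K(2) by simp
  qed
  moreover have "L \<noteq> carrier M" using L(3) x(1) by blast
  ultimately have "maximal_submodule L R M"
    using L(1) unfolding maximal_submodule_def by simp
  then show ?thesis using L by blast
qed

lemma maximal_submodule_comaximal:
  assumes "maximal_submodule L R M" "x \<in> carrier M" "x \<notin> L"
  shows "L <+>\<^bsub>M\<^esub> cyclic_submodule R M x = carrier M"
proof -
  let ?S = "L <+>\<^bsub>M\<^esub> cyclic_submodule R M x"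
  have L: "submodule L R M" and C: "submodule (cyclic_submodule R M x) R M"
    using assms cyclic_submodule_is_submodule unfolding maximal_submodule_def by auto
  have "submodule ?S R M" "L \<subseteq> ?S" "x \<in> ?S"
    using set_add_submodule[OF L C] subset_set_add_left[OF L C] subset_set_add_right[OF L C]
      cyclic_submodule_self[OF assms(2)] by auto
  then show ?thesis using assms(1,3) unfolding maximal_submodule_def by blast
qed

lemma maximal_submodule_nonzero:
  assumes "maximal_submodule L R M" "carrier M \<noteq> {\<zero>\<^bsub>M\<^esub>}" "\<not> simple_module R M"
  shows "L \<noteq> {\<zero>\<^bsub>M\<^esub>}"
  using assms submodule_zero_mem
  unfolding maximal_submodule_def simple_module_def by blast

lemma mem_jacobson_radical_iff_superfluous:
  "x \<in> jacobson_radical R M \<longleftrightarrow> x \<in> carrier M \<and>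
     (\<forall>N. submodule N R M \<and> N <+>\<^bsub>M\<^esub> cyclic_submodule R M x = carrier M \<longrightarrow> N = carrier M)"
  (is "?J \<longleftrightarrow> ?S")
proof
  assume J: ?J
  then have x: "x \<in> carrier M" and max: "\<And>L. maximal_submodule L R M \<Longrightarrow> x \<in> L"
    by (auto simp: jacobson_radical_def)
  have "N = carrier M"
    if N: "submodule N R M" "N <+>\<^bsub>M\<^esub> cyclic_submodule R M x = carrier M" for N
  proof -
    have "x \<in> N"
    proof (rule ccontr)
      assume "x \<notin> N"
      then obtain L where "maximal_submodule L R M" "x \<notin> L"
        using exists_maximal_submodule_avoiding[OF N(1) x _ N(2)] by auto
      then show False using max by simp
    qed
    then have "cyclic_submodule R M x \<subseteq> N"
      by (simp add: cyclic_submodule_subset_iff[OF N(1) x])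
    then have "carrier M \<subseteq> N"
      using set_add_subset_submodule[OF N(1) subset_refl] N(2) by metis
    then show ?thesis using submoduleE(1)[OF N(1)] by simp
  qed
  then show ?S using x by simp
next
  assume S: ?S
  have "x \<in> L" if L: "maximal_submodule L R M" for L
  proof (rule ccontr)
    assume "x \<notin> L"
    then have "L <+>\<^bsub>M\<^esub> cyclic_submodule R M x = carrier M"
      using maximal_submodule_comaximal[OF L] S by simp
    moreover have "submodule L R M" "L \<noteq> carrier M"
      using L by (auto simp: maximal_submodule_def)
    ultimately show False using S by metis
  qed
  moreover have "x \<in> carrier M" using S by (rule conjunct1)
  ultimately show ?J by (simp add: jacobson_radical_def)
qed

lemma jacobson_radical_smult_closed:
  assumes "a \<in> carrier R" "x \<in> jacobson_radical R M"
  shows "a \<odot>\<^bsub>M\<^esub> x \<in> jacobson_radical R M"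
  using assms by (simp add: jacobson_radical_def maximal_submodule_def submoduleE(4))

lemma zero_mem_jacobson_radical: "\<zero>\<^bsub>M\<^esub> \<in> jacobson_radical R M"
  by (simp add: jacobson_radical_def maximal_submodule_def submodule_zero_mem)

end

section \<open>Multiplication modules with prime annihilator\<close>

locale prime_multiplication_module = Module.module +
  assumes multiplication: "multiplication_module R M"
    and prime: "primeideal (annihilator R M) R"
begin

text \<open>If \<open>N = I M\<close> is nonzero, then \<open>I\<close> is not contained in \<open>ann(M)\<close>.\<close>

lemma nonzero_submodule_multiplier:
  assumes N: "submodule N R M" "N \<noteq> {\<zero>\<^bsub>M\<^esub>}"
  obtains a where "a \<in> carrier R" "a \<notin> annihilator R M" "\<And>m. m \<in> carrier M \<Longrightarrow> a \<odot>\<^bsub>M\<^esub> m \<in> N"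
proof -
  obtain I where I: "ideal I R" "N = ideal_mult_module I M"
    using multiplication N(1) unfolding multiplication_module_def by blast
  have IR: "I \<subseteq> carrier R" using ideal.Icarr[OF I(1)] by auto
  have "\<exists>a \<in> I. a \<notin> annihilator R M"
  proof (rule ccontr)
    assume "\<not> ?thesis"
    then have "N \<subseteq> {\<zero>\<^bsub>M\<^esub>}"
      unfolding I(2) by (intro ideal_mult_module_subset[OF zero_submodule]) (auto simp: annihilator_def)
    then show False using N submodule_zero_mem by blast
  qed
  then obtain a where "a \<in> I" "a \<notin> annihilator R M" by blast
  then show ?thesis using that mem_ideal_mult_module[of a I] IR I(2) by blast
qed

text \<open>\<open>M\<close> is torsion-free over the domain \<open>R / ann(M)\<close>: some \<open>b\<close> outside \<open>ann(M)\<close> maps \<open>M\<close> into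
  \<open>R m\<close>, so \<open>r m = 0\<close> makes \<open>r b\<close> annihilate \<open>M\<close>, and primality removes \<open>b\<close>.\<close>

lemma smult_eq_zero_imp_annihilator:
  assumes r: "r \<in> carrier R" and m: "m \<in> carrier M" "m \<noteq> \<zero>\<^bsub>M\<^esub>" and rm: "r \<odot>\<^bsub>M\<^esub> m = \<zero>\<^bsub>M\<^esub>"
  shows "r \<in> annihilator R M"
proof -
  obtain b where b: "b \<in> carrier R" "b \<notin> annihilator R M"
    and bM: "\<And>n. n \<in> carrier M \<Longrightarrow> b \<odot>\<^bsub>M\<^esub> n \<in> cyclic_submodule R M m"
    using nonzero_submodule_multiplier[OF cyclic_submodule_is_submodule cyclic_submodule_nonzero] m
    by metis
  have "(r \<otimes> b) \<odot>\<^bsub>M\<^esub> n = \<zero>\<^bsub>M\<^esub>" if n: "n \<in> carrier M" for n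
  proof -
    obtain s where s: "s \<in> carrier R" "b \<odot>\<^bsub>M\<^esub> n = s \<odot>\<^bsub>M\<^esub> m"
      using bM[OF n] unfolding cyclic_submodule_def by blast
    have "(r \<otimes> b) \<odot>\<^bsub>M\<^esub> n = (r \<otimes> s) \<odot>\<^bsub>M\<^esub> m"
      using r b s m n by (simp add: smult_assoc1)
    also have "\<dots> = s \<odot>\<^bsub>M\<^esub> (r \<odot>\<^bsub>M\<^esub> m)"
      using r s m by (simp add: R.m_comm[of r s] smult_assoc1)
    finally show ?thesis using rm s by simp
  qed
  then have "r \<otimes> b \<in> annihilator R M" using r b by (auto simp: annihilator_def)
  then show ?thesis using primeideal.I_prime[OF prime r b(1)] b(2) by blast
qed

text \<open>Uniformity of \<open>M\<close> upgrades avoiding one nonzero element to avoiding three: a submodule without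
  a given element of \<open>R x \<inter> R y \<inter> R w\<close> contains none of the generators.\<close>

lemma maximal_submodule_avoiding_three:
  assumes J: "jacobson_radical R M = {\<zero>\<^bsub>M\<^esub>}"
    and x: "x \<in> carrier M" "x \<noteq> \<zero>\<^bsub>M\<^esub>" and y: "y \<in> carrier M" "y \<noteq> \<zero>\<^bsub>M\<^esub>"
    and w: "w \<in> carrier M" "w \<noteq> \<zero>\<^bsub>M\<^esub>"
  shows "\<exists>L. maximal_submodule L R M \<and> x \<notin> L \<and> y \<notin> L \<and> w \<notin> L"
proof -
  let ?C = "cyclic_submodule R M"
  let ?D = "?C x \<inter> ?C y \<inter> ?C w"
  note C = cyclic_submodule_is_submodule and nz = cyclic_submodule_nonzero
  have xy: "submodule (?C x \<inter> ?C y) R M" "?C x \<inter> ?C y \<noteq> {\<zero>\<^bsub>M\<^esub>}"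
    using submodule_Int[OF C C] submodule_Int_nonzero[OF multiplication prime C nz C nz] x y by auto
  have "submodule ?D R M" "?D \<noteq> {\<zero>\<^bsub>M\<^esub>}"
    using submodule_Int[OF xy(1) C] submodule_Int_nonzero[OF multiplication prime xy C nz] w by auto
  then obtain z where z: "z \<in> ?D" "z \<noteq> \<zero>\<^bsub>M\<^esub>" "z \<in> carrier M"
    using submodule_zero_mem[of ?D] submoduleE(1)[of ?D] by blast
  then have "z \<notin> jacobson_radical R M" using J by blast
  then obtain L where L: "maximal_submodule L R M" "z \<notin> L"
    using z(3) unfolding jacobson_radical_def by blast
  then have "\<And>v. v \<in> carrier M \<Longrightarrow> z \<in> ?C v \<Longrightarrow> v \<notin> L"
    using cyclic_submodule_subset_iff unfolding maximal_submodule_def by blast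
  then show ?thesis using L(1) z(1) x y w by blast
qed

text \<open>A multiplier \<open>a\<close> of a proper nonzero submodule \<open>N\<close> supplies the second element, since \<open>a x = x\<close>
  would put \<open>1 - a\<close> into \<open>ann(M)\<close>.\<close>

lemma jacobson_radical_two_nonzero:
  assumes nt: "carrier M \<noteq> {\<zero>\<^bsub>M\<^esub>}" and ns: "\<not> simple_module R M"
    and x: "x \<in> jacobson_radical R M" "x \<noteq> \<zero>\<^bsub>M\<^esub>"
  shows "\<exists>y \<in> jacobson_radical R M. y \<noteq> \<zero>\<^bsub>M\<^esub> \<and> y \<noteq> x"
proof -
  have xc: "x \<in> carrier M" using x by (simp add: jacobson_radical_def)
  obtain N where N: "submodule N R M" "N \<noteq> {\<zero>\<^bsub>M\<^esub>}" "N \<noteq> carrier M"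
    using nt ns unfolding simple_module_def by blast
  obtain a where a: "a \<in> carrier R" "a \<notin> annihilator R M"
    and aM: "\<And>m. m \<in> carrier M \<Longrightarrow> a \<odot>\<^bsub>M\<^esub> m \<in> N"
    using nonzero_submodule_multiplier[OF N(1,2)] by blast
  have "a \<odot>\<^bsub>M\<^esub> x \<noteq> x"
  proof
    assume "a \<odot>\<^bsub>M\<^esub> x = x"
    have diff: "(\<one> \<ominus> a) \<odot>\<^bsub>M\<^esub> m = m \<ominus>\<^bsub>M\<^esub> a \<odot>\<^bsub>M\<^esub> m" if "m \<in> carrier M" for m
      using a that by (simp add: a_minus_def smult_l_distr smult_l_minus)
    have "(\<one> \<ominus> a) \<odot>\<^bsub>M\<^esub> x = \<zero>\<^bsub>M\<^esub>"
      using diff[OF xc] \<open>a \<odot>\<^bsub>M\<^esub> x = x\<close> xc by (simp add: a_minus_def M.r_neg)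
    then have ann: "\<one> \<ominus> a \<in> annihilator R M"
      using smult_eq_zero_imp_annihilator[of "\<one> \<ominus> a" x] a xc x(2) by simp
    have "m \<in> N" if m: "m \<in> carrier M" for m
    proof -
      have "m \<ominus>\<^bsub>M\<^esub> a \<odot>\<^bsub>M\<^esub> m = \<zero>\<^bsub>M\<^esub>" using ann diff[OF m] m by (auto simp: annihilator_def)
      then have "m = a \<odot>\<^bsub>M\<^esub> m" using a m by (simp add: minus_eq_zero_iff)
      then show ?thesis using aM[OF m] by simp
    qed
    then show False using N submoduleE(1) by blast
  qed
  moreover have "a \<odot>\<^bsub>M\<^esub> x \<noteq> \<zero>\<^bsub>M\<^esub>"
    using smult_eq_zero_imp_annihilator a xc x(2) by blast
  ultimately show ?thesis using jacobson_radical_smult_closed[OF a(1) x(1)] by blast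
qed

section \<open>Neighbourhoods in the Golomb topology\<close>

lemma openin_coset:
  assumes "x \<in> carrier M" "submodule N R M" "N \<noteq> {\<zero>\<^bsub>M\<^esub>}"
    and "N <+>\<^bsub>M\<^esub> cyclic_submodule R M x = carrier M"
  shows "openin (golomb_topology_full R M) (x <+\<^bsub>M\<^esub> N)"
proof -
  have "x <+\<^bsub>M\<^esub> N \<in> golomb_basis R M" using assms unfolding golomb_basis_def by blast
  then show ?thesis
    unfolding openin_golomb_topology_full[OF multiplication prime]
    by (intro exI[of _ "{x <+\<^bsub>M\<^esub> N}"]) auto
qed

lemma openin_maximal_coset:
  assumes "\<not> simple_module R M" "maximal_submodule L R M" "x \<in> carrier M" "x \<notin> L"
  shows "openin (golomb_topology_full R M) (x <+\<^bsub>M\<^esub> L)"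
proof -
  have L: "submodule L R M" using assms by (simp add: maximal_submodule_def)
  have "carrier M \<noteq> {\<zero>\<^bsub>M\<^esub>}" using assms submodule_zero_mem[OF L] by auto
  then show ?thesis
    using openin_coset maximal_submodule_nonzero maximal_submodule_comaximal assms L by blast
qed

lemma self_mem_coset:
  assumes "x \<in> carrier M" "submodule N R M"
  shows "x \<in> x <+\<^bsub>M\<^esub> N"
  using assms submodule_zero_mem by (simp add: coset_mem_iff a_minus_def M.r_neg)

text \<open>A basic set \<open>m + N\<close> around \<open>x\<close> also satisfies \<open>N + R x = M\<close>, and a superfluous \<open>R x\<close> leaves
  only \<open>N = M\<close>.\<close>

lemma open_containing_jacobson_radical_point:
  assumes U: "openin (golomb_topology_full R M) U" and x: "x \<in> U" "x \<in> jacobson_radical R M"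
  shows "U = carrier M"
proof -
  obtain \<F> where \<F>: "\<F> \<subseteq> golomb_basis R M" "U = \<Union>\<F>"
    using U openin_golomb_topology_full[OF multiplication prime] by blast
  then obtain B where B: "B \<in> golomb_basis R M" "x \<in> B" "B \<subseteq> U" using x by blast
  then obtain m N where N: "B = m <+\<^bsub>M\<^esub> N" "m \<in> carrier M" "submodule N R M"
    "N <+>\<^bsub>M\<^esub> cyclic_submodule R M m = carrier M"
    unfolding golomb_basis_def by blast
  then have "N = carrier M"
    using comaximal_coset[OF N(2,3) _ N(4), of x] B(2) x(2)
    unfolding mem_jacobson_radical_iff_superfluous by blast
  then have "carrier M \<subseteq> B" using N coset_mem_iff[OF N(2) _ N(3)] by auto
  then show ?thesis using B(3) \<F> golomb_basis_subset_carrier by blast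
qed

lemma closure_of_zero_eq_jacobson_radical:
  assumes "carrier M \<noteq> {\<zero>\<^bsub>M\<^esub>}" "\<not> simple_module R M"
  shows "golomb_topology_full R M closure_of {\<zero>\<^bsub>M\<^esub>} = jacobson_radical R M"
proof (intro Set.set_eqI iffI)
  fix x assume x: "x \<in> golomb_topology_full R M closure_of {\<zero>\<^bsub>M\<^esub>}"
  then have xc: "x \<in> carrier M"
    using topspace_golomb_topology_full[OF multiplication prime assms(1)]
    by (simp add: in_closure_of)
  have "x \<in> L" if L: "maximal_submodule L R M" for L
  proof (rule ccontr)
    assume "x \<notin> L"
    have sL: "submodule L R M" using L by (simp add: maximal_submodule_def)
    have "\<zero>\<^bsub>M\<^esub> \<in> x <+\<^bsub>M\<^esub> L"
      using x openin_maximal_coset[OF assms(2) L xc \<open>x \<notin> L\<close>] self_mem_coset[OF xc sL]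
      unfolding in_closure_of by blast
    then have "\<ominus>\<^bsub>M\<^esub> x \<in> L" using coset_mem_iff[OF xc _ sL] xc by (simp add: a_minus_def)
    then show False using submoduleE(3)[OF sL] xc \<open>x \<notin> L\<close> by fastforce
  qed
  then show "x \<in> jacobson_radical R M" using xc by (simp add: jacobson_radical_def)
next
  fix x assume x: "x \<in> jacobson_radical R M"
  then show "x \<in> golomb_topology_full R M closure_of {\<zero>\<^bsub>M\<^esub>}"
    using open_containing_jacobson_radical_point
      topspace_golomb_topology_full[OF multiplication prime assms(1)]
    by (auto simp: in_closure_of jacobson_radical_def)
qed

section \<open>Separation axioms\<close>

lemma topspace_golomb_topology:
  assumes "carrier M \<noteq> {\<zero>\<^bsub>M\<^esub>}"
  shows "topspace (golomb_topology R M) = carrier M - {\<zero>\<^bsub>M\<^esub>}"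
  using topspace_golomb_topology_full[OF multiplication prime assms]
  by (auto simp: golomb_topology_def)

lemma Hausdorff_if_jacobson_semisimple:
  assumes nt: "carrier M \<noteq> {\<zero>\<^bsub>M\<^esub>}" and ns: "\<not> simple_module R M"
    and J: "jacobson_radical R M = {\<zero>\<^bsub>M\<^esub>}"
  shows "Hausdorff_space (golomb_topology R M)"
  unfolding Hausdorff_space_def topspace_golomb_topology[OF nt]
proof (intro allI impI)
  fix x y assume "x \<in> carrier M - {\<zero>\<^bsub>M\<^esub>} \<and> y \<in> carrier M - {\<zero>\<^bsub>M\<^esub>} \<and> x \<noteq> y"
  then have x: "x \<in> carrier M" "x \<noteq> \<zero>\<^bsub>M\<^esub>" and y: "y \<in> carrier M" "y \<noteq> \<zero>\<^bsub>M\<^esub>"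
    and xy: "x \<ominus>\<^bsub>M\<^esub> y \<in> carrier M" "x \<ominus>\<^bsub>M\<^esub> y \<noteq> \<zero>\<^bsub>M\<^esub>"
    by (auto simp: minus_eq_zero_iff)
  obtain L where L: "maximal_submodule L R M" "x \<notin> L" "y \<notin> L" "x \<ominus>\<^bsub>M\<^esub> y \<notin> L"
    using maximal_submodule_avoiding_three[OF J x y xy] by blast
  then have sL: "submodule L R M" by (simp add: maximal_submodule_def)
  let ?G = "carrier M - {\<zero>\<^bsub>M\<^esub>}"
  let ?U = "(x <+\<^bsub>M\<^esub> L) \<inter> ?G" and ?V = "(y <+\<^bsub>M\<^esub> L) \<inter> ?G"
  have open_UV: "openin (golomb_topology R M) ?U" "openin (golomb_topology R M) ?V"
    using openin_maximal_coset[OF ns L(1)] L x y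
    unfolding golomb_topology_def openin_subtopology by blast+
  have disj: "disjnt ?U ?V"
  proof (rule ccontr)
    assume "\<not> disjnt ?U ?V"
    then obtain u where u: "u \<in> carrier M" "u \<in> x <+\<^bsub>M\<^esub> L" "u \<in> y <+\<^bsub>M\<^esub> L"
      by (auto simp: disjnt_def)
    then have "(u \<ominus>\<^bsub>M\<^esub> y) \<ominus>\<^bsub>M\<^esub> (u \<ominus>\<^bsub>M\<^esub> x) \<in> L"
      using submodule_minus_mem[OF sL] coset_mem_iff[OF _ u(1) sL] x y by blast
    moreover have "(u \<ominus>\<^bsub>M\<^esub> y) \<ominus>\<^bsub>M\<^esub> (u \<ominus>\<^bsub>M\<^esub> x) = x \<ominus>\<^bsub>M\<^esub> y"
      using u(1) x(1) y(1)
      by (simp add: a_minus_def M.minus_add M.a_ac M.r_neg1 M.r_neg2)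
    ultimately show False using L(4) by simp
  qed
  have "x \<in> ?U" "y \<in> ?V" using self_mem_coset[OF _ sL] x y by auto
  then show "\<exists>U V. openin (golomb_topology R M) U \<and> openin (golomb_topology R M) V \<and>
      x \<in> U \<and> y \<in> V \<and> disjnt U V"
    using open_UV disj by blast
qed

lemma jacobson_semisimple_if_T0:
  assumes nt: "carrier M \<noteq> {\<zero>\<^bsub>M\<^esub>}" and ns: "\<not> simple_module R M"
    and T0: "t0_space (golomb_topology R M)"
  shows "jacobson_radical R M = {\<zero>\<^bsub>M\<^esub>}"
proof (rule ccontr)
  assume "\<not> ?thesis"
  then obtain x where x: "x \<in> jacobson_radical R M" "x \<noteq> \<zero>\<^bsub>M\<^esub>"
    using zero_mem_jacobson_radical by blast
  then obtain y where y: "y \<in> jacobson_radical R M" "y \<noteq> \<zero>\<^bsub>M\<^esub>" "y \<noteq> x"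
    using jacobson_radical_two_nonzero[OF nt ns] by blast
  have c: "x \<in> carrier M" "y \<in> carrier M" using x y by (auto simp: jacobson_radical_def)
  then obtain U where "openin (golomb_topology R M) U" "x \<in> U \<longleftrightarrow> y \<notin> U"
    using T0 x y unfolding t0_space_def topspace_golomb_topology[OF nt] by blast
  then obtain T where "openin (golomb_topology_full R M) T" "x \<in> T \<longleftrightarrow> y \<notin> T"
    using x y c unfolding golomb_topology_def openin_subtopology by blast
  then show False using open_containing_jacobson_radical_point x y c by blast
qed

text \<open>Passing from the nonzero points to all of \<open>M\<close> only adds the pairs that involve \<open>0\<close>; these are
  separated because the closed point \<open>0\<close> has an open complement.\<close>

lemma T0_full_if_T0:
  assumes nt: "carrier M \<noteq> {\<zero>\<^bsub>M\<^esub>}" and ns: "\<not> simple_module R M"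
    and T0: "t0_space (golomb_topology R M)"
  shows "t0_space (golomb_topology_full R M)"
  unfolding t0_space_def
proof (intro ballI impI)
  let ?X = "golomb_topology_full R M"
  have top: "topspace ?X = carrier M"
    by (rule topspace_golomb_topology_full[OF multiplication prime nt])
  have "?X closure_of {\<zero>\<^bsub>M\<^esub>} = {\<zero>\<^bsub>M\<^esub>}"
    using closure_of_zero_eq_jacobson_radical[OF nt ns] jacobson_semisimple_if_T0[OF assms] by simp
  then have "closedin ?X {\<zero>\<^bsub>M\<^esub>}" by (metis closedin_closure_of)
  then have o: "openin ?X (carrier M - {\<zero>\<^bsub>M\<^esub>})" using top by (simp add: closedin_def)
  fix x y assume xy: "x \<in> topspace ?X" "y \<in> topspace ?X" "x \<noteq> y"
  show "\<exists>U. openin ?X U \<and> (x \<notin> U) = (y \<in> U)"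
  proof (cases "x = \<zero>\<^bsub>M\<^esub> \<or> y = \<zero>\<^bsub>M\<^esub>")
    case True
    then show ?thesis using o xy top by blast
  next
    case False
    then obtain U where "openin (golomb_topology R M) U" "x \<notin> U \<longleftrightarrow> y \<in> U"
      using T0 xy top unfolding t0_space_def topspace_golomb_topology[OF nt] by blast
    then show ?thesis
      using False xy top unfolding golomb_topology_def openin_subtopology by blast
  qed
qed

end

theorem theorem7:
  fixes R :: "('a, 'c) ring_scheme" and M :: "('a, 'b, 'd) module_scheme"
  assumes "module R M"
    and "\<one>\<^bsub>R\<^esub> \<noteq> \<zero>\<^bsub>R\<^esub>"
    and "carrier M \<noteq> {\<zero>\<^bsub>M\<^esub>}"
    and "\<not> simple_module R M"
    and "multiplication_module R M"
    and "primeideal (annihilator R M) R"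
  shows "(jacobson_radical R M = {\<zero>\<^bsub>M\<^esub>} \<longleftrightarrow> Hausdorff_space (golomb_topology R M)) \<and>
         (Hausdorff_space (golomb_topology R M) \<longleftrightarrow> t1_space (golomb_topology R M)) \<and>
         (t1_space (golomb_topology R M) \<longleftrightarrow> t0_space (golomb_topology R M)) \<and>
         (t0_space (golomb_topology R M) \<longleftrightarrow> t0_space (golomb_topology_full R M)) \<and>
         (t0_space (golomb_topology_full R M) \<longleftrightarrow>
            golomb_topology_full R M closure_of {\<zero>\<^bsub>M\<^esub>} = {\<zero>\<^bsub>M\<^esub>})"
proof -
  interpret prime_multiplication_module R M
    using assms by (simp add: prime_multiplication_module_def prime_multiplication_module_axioms_def)
  let ?G = "golomb_topology R M" and ?X = "golomb_topology_full R M"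
  have "jacobson_radical R M = {\<zero>\<^bsub>M\<^esub>} \<Longrightarrow> Hausdorff_space ?G"
    by (rule Hausdorff_if_jacobson_semisimple) (use assms in auto)
  moreover have "Hausdorff_space ?G \<Longrightarrow> t1_space ?G" by (rule Hausdorff_imp_t1_space)
  moreover have "t1_space ?G \<Longrightarrow> t0_space ?G" by (rule t1_imp_t0_space)
  moreover have "t0_space ?G \<Longrightarrow> jacobson_radical R M = {\<zero>\<^bsub>M\<^esub>}"
    by (rule jacobson_semisimple_if_T0) (use assms in auto)
  moreover have "t0_space ?G \<Longrightarrow> t0_space ?X"
    by (rule T0_full_if_T0) (use assms in auto)
  moreover have "t0_space ?X \<Longrightarrow> t0_space ?G"
    unfolding golomb_topology_def by (rule t0_space_subtopology)
  moreover have "?X closure_of {\<zero>\<^bsub>M\<^esub>} = jacobson_radical R M"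
    by (rule closure_of_zero_eq_jacobson_radical) (use assms in auto)
  ultimately show ?thesis by metis
qed

end
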